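(* Let $n\ge 2$. Then $!!n$ and $-\frac{!!n}{2(n-1)}$ are eigenvalues of the matching derangement graph $\Gamma$ on $\mathcal{M}_{2n}$.
   Context: $\mathcal{M}_{2n}$ is the set of perfect matchings of $K_{2n}$; $\Gamma$ has vertex set $\mathcal{M}_{2n}$, two matchings adjacent iff they share no edge. $!!n$ denotes the number of perfect matchings of $K_{2n}$ sharing no edge with a fixed perfect matching (so $\Gamma$ is $!!n$-regular); it satisfies $!!n = 2(n-1)(!!(n-1)+!!(n-2))$ with $!!0=1$, $!!1=0$. *)

theory Defs
  imports Jordan_Normal_Form.Char_Poly
begin

text \<open>An undirected graph is a pair of its vertex set and its edge set, an edge being the set of its
  end points.\<close>

type_synonym 'a ugraph = "'a set \<times> 'a set set"

definition complete_graph :: "nat \<Rightarrow> nat ugraph" where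
  "complete_graph m = ({..<m}, {e. e \<subseteq> {..<m} \<and> card e = 2})"

definition perfect_matchings :: "'a ugraph \<Rightarrow> 'a set set set" where
  "perfect_matchings G =
     {M. M \<subseteq> snd G \<and> (\<forall>v \<in> fst G. \<exists>!e. e \<in> M \<and> v \<in> e)}"

text \<open>For \<open>n \<ge> 1\<close> perfect matchings of the complete graph on \<open>2 * n\<close> vertices are nonempty,
  so that disjoint ones are distinct and this graph has no loops.\<close>

definition matching_derangement_graph :: "nat \<Rightarrow> nat set set ugraph" where
  "matching_derangement_graph n =
     (let \<M> = perfect_matchings (complete_graph (2 * n))
      in (\<M>, {{M, M'} |M M'. M \<in> \<M> \<and> M' \<in> \<M> \<and> M \<inter> M' = {}}))"

text \<open>The count written \<open>!!n\<close>, with the fixed perfect matching \<open>M\<^sub>0\<close> kept as an argument.\<close>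

definition matching_derangements :: "nat \<Rightarrow> nat set set \<Rightarrow> nat" where
  "matching_derangements n M\<^sub>0 =
     card {M \<in> perfect_matchings (complete_graph (2 * n)). M \<inter> M\<^sub>0 = {}}"

definition adjacency_mat :: "'a ugraph \<Rightarrow> 'a list \<Rightarrow> real mat" where
  "adjacency_mat G vs =
     mat (length vs) (length vs) (\<lambda>(i, j). if {vs ! i, vs ! j} \<in> snd G then 1 else 0)"

text \<open>Matrices are indexed by natural numbers, so an adjacency matrix depends on an enumeration of
  the vertices. Different enumerations give permutation-similar matrices; the definition asks for all
  of them, and finiteness excludes the vacuous case.\<close>

definition graph_eigenvalue :: "'a ugraph \<Rightarrow> real \<Rightarrow> bool" where
  "graph_eigenvalue G k \<longleftrightarrow>
     finite (fst G) \<and>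
     (\<forall>vs. distinct vs \<and> set vs = fst G \<longrightarrow> eigenvalue (adjacency_mat G vs) k)"

end

theory Submission
  imports Defs "HOL-Combinatorics.Permutations"
begin

text \<open>Fix an edge \<open>{a, b}\<close>. Splitting the matchings into those that contain \<open>{a, b}\<close> and those
  that do not is an equitable partition of the derangement graph: a matching of the first kind has no
  neighbour of the first kind, and one of the second kind has exactly \<open>!!n / (2 * (n - 1))\<close> of them,
  because the stabiliser in the symmetric group of a matching and of \<open>a\<close> permutes transitively the
  \<open>2 * n - 2\<close> vertices other than \<open>a\<close> and its partner. The two eigenvalues of the quotient matrix are
  the claimed ones; the eigenvectors are constant on the two classes.\<close>

section \<open>Eigenvalues of graphs from functions on the vertices\<close>

text \<open>Frees the rest of the proof from enumerations: an eigenvector becomes a function on the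
  vertices, and for each enumeration \<open>vs\<close> the matrix-vector product is the sum over
  neighbours, reindexed along the bijection \<open>(!) vs\<close>.\<close>

lemma graph_eigenvalueI:
  fixes G :: "'a ugraph" and f :: "'a \<Rightarrow> real"
  assumes fin: "finite (fst G)" and w: "w \<in> fst G" "f w \<noteq> 0"
    and eq: "\<And>v. v \<in> fst G \<Longrightarrow> (\<Sum>u\<in>fst G. (if {v, u} \<in> snd G then f u else 0)) = k * f v"
  shows "graph_eigenvalue G k"
  unfolding graph_eigenvalue_def
proof (intro conjI allI impI)
  show "finite (fst G)" by (rule fin)
next
  fix vs assume vs: "distinct vs \<and> set vs = fst G"
  define x where "x = vec (length vs) (\<lambda>i. f (vs ! i))"
  have bij: "bij_betw ((!) vs) {0..<length vs} (fst G)"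
    using vs bij_betw_nth[of vs "{0..<length vs}" "fst G"] by (simp add: atLeast0LessThan)
  from w(1) vs obtain i where i: "i < length vs" "vs ! i = w"
    by (metis in_set_conv_nth)
  have "x \<noteq> 0\<^sub>v (length vs)"
    using i w(2) unfolding x_def by (metis index_vec index_zero_vec(1))
  moreover have "adjacency_mat G vs *\<^sub>v x = k \<cdot>\<^sub>v x"
  proof (rule eq_vecI)
    fix i assume "i < dim_vec (k \<cdot>\<^sub>v x)"
    then have i: "i < length vs" by (simp add: x_def)
    then have mem: "vs ! i \<in> fst G" using vs nth_mem by blast
    have "(adjacency_mat G vs *\<^sub>v x) $ i
      = (\<Sum>j = 0..<length vs. (if {vs ! i, vs ! j} \<in> snd G then f (vs ! j) else 0))"
      using i by (auto simp: adjacency_mat_def x_def scalar_prod_def intro!: sum.cong)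
    also have "\<dots> = (\<Sum>u\<in>fst G. (if {vs ! i, u} \<in> snd G then f u else 0))"
      by (rule sum.reindex_bij_betw[OF bij])
    also have "\<dots> = (k \<cdot>\<^sub>v x) $ i" using eq[OF mem] i by (simp add: x_def)
    finally show "(adjacency_mat G vs *\<^sub>v x) $ i = (k \<cdot>\<^sub>v x) $ i" .
  qed (simp add: adjacency_mat_def x_def)
  ultimately have "eigenvector (adjacency_mat G vs) x k"
    by (simp add: eigenvector_def adjacency_mat_def x_def)
  then show "eigenvalue (adjacency_mat G vs) k"
    unfolding eigenvalue_def by blast
qed

section \<open>Perfect matchings of complete graphs\<close>

abbreviation matchings :: "nat \<Rightarrow> nat set set set" where
  "matchings m \<equiv> perfect_matchings (complete_graph m)"

lemma matchings_iff:
  "M \<in> matchings m \<longleftrightarrow>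
    (\<forall>e\<in>M. e \<subseteq> {..<m} \<and> card e = 2) \<and> (\<forall>v<m. \<exists>!e. e \<in> M \<and> v \<in> e)"
  by (auto simp: perfect_matchings_def complete_graph_def)

lemma matching_edgeD:
  assumes "M \<in> matchings m" "e \<in> M"
  shows "e \<subseteq> {..<m}" "card e = 2"
  using assms by (simp_all add: matchings_iff)

lemma finite_matchings: "finite (matchings m)"
proof (rule finite_subset)
  show "matchings m \<subseteq> Pow (Pow {..<m})"
    using matching_edgeD(1) by blast
qed simp

lemma finite_matching: "M \<in> matchings m \<Longrightarrow> finite M"
  using matching_edgeD(1) by (intro finite_subset[of M "Pow {..<m}"]) auto

lemma matching_edge_unique:
  assumes "M \<in> matchings m" "e \<in> M" "e' \<in> M" "v \<in> e" "v \<in> e'"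
  shows "e = e'"
proof -
  have "v < m" using matching_edgeD(1)[OF assms(1,2)] assms(4) by blast
  then show ?thesis using assms by (metis matchings_iff)
qed

lemma matching_partner:
  assumes M: "M \<in> matchings m" and v: "v < m"
  obtains w where "w < m" "w \<noteq> v" "{v, w} \<in> M"
proof -
  obtain e where e: "e \<in> M" "v \<in> e" using M v by (metis matchings_iff)
  have "card e = 2" "e \<subseteq> {..<m}" using matching_edgeD[OF M e(1)] by auto
  then obtain x y where "e = {x, y}" "x \<noteq> y" by (auto simp: card_2_iff)
  with e(2) obtain w where "e = {v, w}" "w \<noteq> v" by auto
  with e \<open>e \<subseteq> {..<m}\<close> show ?thesis by (intro that[of w]) auto
qed

lemma Union_matching:
  assumes "M \<in> matchings m"
  shows "\<Union>M = {..<m}"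
proof
  show "\<Union>M \<subseteq> {..<m}" using matching_edgeD(1)[OF assms] by blast
  show "{..<m} \<subseteq> \<Union>M" using matching_partner[OF assms] by blast
qed

lemma card_matching:
  assumes M: "M \<in> matchings m"
  shows "2 * card M = m"
proof -
  have "2 * card M = card (\<Union>M)"
  proof (rule card_partition)
    show "finite M" using M by (rule finite_matching)
    show "finite (\<Union>M)" unfolding Union_matching[OF M] by simp
    show "card e = 2" if "e \<in> M" for e using M that by (rule matching_edgeD)
    show "e \<inter> e' = {}" if "e \<in> M" "e' \<in> M" "e \<noteq> e'" for e e'
      using matching_edge_unique[OF M that(1,2)] that(3) by blast
  qed
  then show ?thesis by (simp add: Union_matching[OF M])
qed

section \<open>The action of the symmetric group\<close>

lemma permutes_matchings:
  assumes p: "p permutes {..<m}" and M: "M \<in> matchings m"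
  shows "image p ` M \<in> matchings m"
  unfolding matchings_iff
proof (intro conjI ballI allI impI)
  fix e assume "e \<in> image p ` M"
  then obtain e' where e': "e' \<in> M" "e = p ` e'" by auto
  show "e \<subseteq> {..<m}" "card e = 2"
    using matching_edgeD[OF M e'(1)] e'(2) permutes_image[OF p]
      card_image[OF inj_on_subset[OF permutes_inj[OF p]], of e'] by auto
next
  fix v assume "v < m"
  then obtain u where u: "u < m" "v = p u"
    using permutes_image[OF p] by (metis imageE lessThan_iff)
  have iff: "v \<in> p ` e \<longleftrightarrow> u \<in> e" for e
    using u permutes_inj[OF p] by (simp add: inj_image_mem_iff)
  obtain e where e: "e \<in> M" "u \<in> e" using M u(1) by (metis matchings_iff)
  show "\<exists>!e. e \<in> image p ` M \<and> v \<in> e"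
  proof (rule ex1I[of _ "p ` e"])
    show "p ` e \<in> image p ` M \<and> v \<in> p ` e" using e by (simp add: iff)
    fix e' assume "e' \<in> image p ` M \<and> v \<in> e'"
    then obtain e'' where e'': "e'' \<in> M" "u \<in> e''" "e' = p ` e''" using iff by blast
    then show "e' = p ` e" using matching_edge_unique[OF M e''(1) e(1) e''(2) e(2)] by simp
  qed
qed

text \<open>Relabelling vertices by \<open>p\<close> is undone by relabelling with its inverse, and
  injectivity of \<open>image p\<close> preserves both disjointness and inclusion. The prescribed
  edges \<open>F\<close> let one statement serve twice: \<open>F = {}\<close> for the degree of the
  graph, a single edge for the finer count.\<close>

lemma card_disjoint_matchings_permute:
  assumes p: "p permutes {..<m}"
  shows "card {M' \<in> matchings m. M' \<inter> M = {} \<and> F \<subseteq> M'}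
    = card {M' \<in> matchings m. M' \<inter> image p ` M = {} \<and> image p ` F \<subseteq> M'}"
    (is "card ?A = card ?B")
proof (rule bij_betw_same_card)
  let ?f = "image (image p)" and ?g = "image (image (inv_into UNIV p))"
  have injp: "inj p" and surjp: "surj p" using p permutes_inj permutes_surj by blast+
  have injf: "inj (image p)" using injp by (simp add: inj_image_eq_iff inj_def)
  have fg: "?g (?f X) = X" "?f (?g X) = X" for X
    using injp surjp by (simp_all add: image_image surj_f_inv_f)
  have f: "?f M' \<in> ?B \<longleftrightarrow> ?f M' \<in> matchings m \<and> M' \<inter> M = {} \<and> F \<subseteq> M'" for M'
    using injf image_Int[OF injf, of M' M] by (auto simp: inj_image_subset_iff)
  show "bij_betw ?f ?A ?B"
  proof (rule bij_betw_byWitness[where f' = ?g])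
    show "?f ` ?A \<subseteq> ?B"
    proof
      fix X assume "X \<in> ?f ` ?A"
      then obtain Y where Y: "Y \<in> ?A" "X = ?f Y" by blast
      then show "X \<in> ?B" unfolding Y(2) f using permutes_matchings[OF p] by simp
    qed
    show "?g ` ?B \<subseteq> ?A"
    proof
      fix X assume "X \<in> ?g ` ?B"
      then obtain Y where Y: "Y \<in> ?B" "X = ?g Y" by blast
      then have "X \<in> matchings m" using permutes_matchings[OF permutes_inv[OF p]] by blast
      then show "X \<in> ?A" using Y f[of "?g Y"] unfolding fg by blast
    qed
  qed (simp_all only: fg, simp_all)
qed

text \<open>Both matchings have the same number of edges, so a bijection \<open>s\<close> between
  their edges exists; it lifts to the vertices once each edge is oriented by the order on
  \<open>nat\<close>.\<close>

lemma matchings_transitive: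
  assumes M: "M \<in> matchings m" and N: "N \<in> matchings m"
  obtains p where "p permutes {..<m}" "image p ` M = N"
proof -
  have "card M = card N" using card_matching[OF M] card_matching[OF N] by simp
  then obtain s where s: "bij_betw s M N"
    using finite_same_card_bij[OF finite_matching[OF M] finite_matching[OF N]] by blast
  have edge: "\<exists>x y. e = {x, y} \<and> x < y \<and> y < m" if "L \<in> matchings m" "e \<in> L" for e L
  proof -
    have "card e = 2" "e \<subseteq> {..<m}" using matching_edgeD[OF that] by auto
    then obtain x y where "e = {x, y}" "x < y" by (metis card_2_iff insert_commute nat_neq_iff)
    with \<open>e \<subseteq> {..<m}\<close> show ?thesis by auto
  qed
  define E where "E v = (THE e. e \<in> M \<and> v \<in> e)" for v
  \<comment> \<open>The smaller end of an edge goes to the smaller end of its image under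
    \<open>s\<close>, the larger end to the larger; outside \<open>{..<m}\<close> the map is the
    identity, as \<open>permutes\<close> demands.\<close>
  define p where "p v = (if v < m then
      if v = Min (E v) then Min (s (E v)) else Max (s (E v)) else v)" for v
  have E: "E v = e" if "e \<in> M" "v \<in> e" for e v
    unfolding E_def
  proof (rule the_equality)
    show "e' = e" if "e' \<in> M \<and> v \<in> e'" for e'
      using that \<open>e \<in> M\<close> \<open>v \<in> e\<close> by (metis matching_edge_unique[OF M])
  qed (simp add: that)
  have img: "p ` e = s e" if e: "e \<in> M" for e
  proof -
    obtain x y where xy: "e = {x, y}" "x < y" "y < m" using edge[OF M e] by blast
    have "s e \<in> N" using s e by (auto simp: bij_betw_def)
    then obtain x' y' where xy': "s e = {x', y'}" "x' < y'" using edge[OF N] by blast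
    have "E x = e" "E y = e" using E[OF e] xy(1) by auto
    then show ?thesis using xy xy' by (simp add: p_def insert_commute)
  qed
  then have imgM: "image p ` M = N" using s by (simp add: bij_betw_def cong: image_cong)
  \<comment> \<open>The edges of \<open>M\<close> cover all vertices, and so do their images, the
    edges of \<open>N\<close>. On a finite set surjectivity then yields injectivity.\<close>
  have surj: "p ` {..<m} = {..<m}"
  proof -
    have UM: "\<Union>M = {..<m}" by (rule Union_matching[OF M])
    have UN: "\<Union>N = {..<m}" by (rule Union_matching[OF N])
    show ?thesis unfolding UM[symmetric] image_Union imgM UN[folded UM] ..
  qed
  have "p permutes {..<m}"
  proof (rule bij_imp_permutes)
    show "bij_betw p {..<m} {..<m}"
      using surj by (simp add: bij_betw_def eq_card_imp_inj_on)
  qed (simp add: p_def)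
  then show ?thesis using imgM by (rule that)
qed

text \<open>This is the regularity of the derangement graph.\<close>

lemma matching_derangements_eq:
  assumes "M \<in> matchings (2 * n)" "N \<in> matchings (2 * n)"
  shows "matching_derangements n M = matching_derangements n N"
proof -
  obtain p where "p permutes {..<2 * n}" "image p ` M = N"
    using matchings_transitive[OF assms] .
  then show ?thesis
    using card_disjoint_matchings_permute[of p "2 * n" M "{}"]
    by (simp add: matching_derangements_def)
qed

text \<open>If \<open>i\<close> and \<open>j\<close> lie on one edge of \<open>M\<close>, swapping
  them preserves that edge; otherwise the edges of \<open>i\<close> and \<open>j\<close> are
  exchanged as a whole. Either way the edge \<open>{a, c}\<close> is left alone.\<close>

lemma matching_stabiliser_transitive:
  assumes M: "M \<in> matchings m" and ac: "{a, c} \<in> M"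
    and i: "i < m" "i \<notin> {a, c}" and j: "j < m" "j \<notin> {a, c}"
  obtains p where "p permutes {..<m}" "image p ` M = M" "p a = a" "p i = j"
proof -
  obtain i' where i': "i' < m" "i' \<noteq> i" "{i, i'} \<in> M" using matching_partner[OF M i(1)] .
  obtain j' where j': "j' < m" "j' \<noteq> j" "{j, j'} \<in> M" using matching_partner[OF M j(1)] .
  note uniq = matching_edge_unique[OF M]
  \<comment> \<open>An injective self-map of the finite set \<open>M\<close> is onto, so below it
    suffices to send edges of \<open>M\<close> to edges of \<open>M\<close>.\<close>
  have eqM: "image p ` M = M" if p: "p permutes {..<m}" "image p ` M \<subseteq> M" for p
  proof (rule endo_inj_surj[OF finite_matching[OF M] p(2)])
    show "inj_on (image p) M"
      using permutes_inj[OF p(1)] by (simp add: inj_on_def inj_image_eq_iff)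
  qed
  have a: "a \<notin> {i, i', j, j'}"
    using uniq[OF ac i'(3), of a] uniq[OF ac j'(3), of a] i j by auto
  show ?thesis
  proof (cases "j \<in> {i, i'}")
    case True
    \<comment> \<open>For \<open>j = i\<close> this is the identity.\<close>
    let ?p = "Transposition.transpose i j"
    have perm: "?p permutes {..<m}" using i j by (intro permutes_swap_id) auto
    have "?p ` e \<in> M" if e: "e \<in> M" for e
    proof (cases "i \<in> e \<or> i' \<in> e")
      case True
      then have "e = {i, i'}" using uniq[OF e i'(3)] by blast
      moreover have "?p ` {i, i'} = {i, i'}" using \<open>j \<in> {i, i'}\<close> by auto
      ultimately show ?thesis using e by simp
    next
      case False
      then have "?p ` e = id ` e"
        using \<open>j \<in> {i, i'}\<close> by (intro image_cong) (auto simp: Transposition.transpose_def)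
      then show ?thesis using e by simp
    qed
    then have "image ?p ` M = M" using eqM[OF perm] by blast
    then show ?thesis using perm a by (intro that[of ?p]) auto
  next
    case False
    \<comment> \<open>Moving \<open>i\<close> alone would break its edge, so its partner
      \<open>i'\<close> moves along to the partner \<open>j'\<close> of \<open>j\<close>. The four
      vertices are distinct.\<close>
    let ?p = "Transposition.transpose i j \<circ> Transposition.transpose i' j'"
    have ne: "i \<noteq> j" "i' \<noteq> j" "i \<noteq> j'" "i' \<noteq> j'"
      using False uniq[OF i'(3) j'(3)] i' j' by auto
    have perm: "?p permutes {..<m}"
      using i j i' j' by (intro permutes_compose permutes_swap_id) auto
    have "?p ` e \<in> M" if e: "e \<in> M" for e
    proof -
      consider "i \<in> e \<or> i' \<in> e" | "j \<in> e \<or> j' \<in> e" | "e \<inter> {i, i', j, j'} = {}" by blast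
      then show ?thesis
      proof cases
        case 1
        then have "e = {i, i'}" using uniq[OF e i'(3)] by blast
        then have "?p ` e = {j, j'}"
          using ne i'(2) j'(2) by (auto simp: Transposition.transpose_def)
        then show ?thesis using j'(3) by simp
      next
        case 2
        then have "e = {j, j'}" using uniq[OF e j'(3)] by blast
        then have "?p ` e = {i, i'}"
          using ne i'(2) j'(2) by (auto simp: Transposition.transpose_def)
        then show ?thesis using i'(3) by simp
      next
        case 3
        then have "?p ` e = id ` e"
          by (intro image_cong) (auto simp: Transposition.transpose_def)
        then show ?thesis using e by simp
      qed
    qed
    then have "image ?p ` M = M" using eqM[OF perm] by blast
    then show ?thesis
      using perm a ne i'(2) by (intro that[of ?p]) (auto simp: Transposition.transpose_def)
  qed
qed

text \<open>A matching disjoint from \<open>M\<close> joins \<open>a\<close> to exactly one vertex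
  other than \<open>a\<close> and its \<open>M\<close>-partner \<open>c\<close>. This splits the
  derangements of \<open>M\<close> into \<open>2 * (n - 1)\<close> classes, which the stabiliser of
  \<open>M\<close> and \<open>a\<close> permutes transitively, so all have the same size.\<close>

lemma card_derangements_through_edge:
  assumes M: "M \<in> matchings (2 * n)" and ab: "a < 2 * n" "b < 2 * n" "a \<noteq> b" "{a, b} \<notin> M"
  shows "2 * (n - 1) * card {M' \<in> matchings (2 * n). M' \<inter> M = {} \<and> {a, b} \<in> M'}
    = matching_derangements n M"
proof -
  let ?S = "\<lambda>j. {M' \<in> matchings (2 * n). M' \<inter> M = {} \<and> {a, j} \<in> M'}"
  obtain c where c: "c < 2 * n" "c \<noteq> a" "{a, c} \<in> M" using matching_partner[OF M ab(1)] .
  let ?J = "{..<2 * n} - {a, c}"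
  have b: "b \<notin> {a, c}" using ab c by auto
  have same: "card (?S j) = card (?S b)" if j: "j \<in> ?J" for j
  proof -
    obtain p where p: "p permutes {..<2 * n}" "image p ` M = M" "p a = a" "p j = b"
      using matching_stabiliser_transitive[OF M c(3), of j b] j ab(2) b by auto
    show ?thesis
      using card_disjoint_matchings_permute[OF p(1), of M "{{a, j}}"] p by simp
  qed
  have "{M' \<in> matchings (2 * n). M' \<inter> M = {}} = (\<Union>j\<in>?J. ?S j)"
  proof (intro equalityI subsetI)
    fix M' assume M': "M' \<in> {M' \<in> matchings (2 * n). M' \<inter> M = {}}"
    then obtain j where "j < 2 * n" "j \<noteq> a" "{a, j} \<in> M'"
      using matching_partner[of M' "2 * n" a] ab by blast
    then show "M' \<in> (\<Union>j\<in>?J. ?S j)" using M' c(3) by blast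
  qed blast
  then have "matching_derangements n M = card (\<Union>j\<in>?J. ?S j)"
    by (simp add: matching_derangements_def)
  also have "\<dots> = (\<Sum>j\<in>?J. card (?S j))"
  proof (rule card_UN_disjoint)
    show "\<forall>i\<in>?J. \<forall>j\<in>?J. i \<noteq> j \<longrightarrow> ?S i \<inter> ?S j = {}"
    proof (intro ballI impI)
      fix i j :: nat assume "i \<noteq> j"
      have "i = j" if "M' \<in> ?S i" "M' \<in> ?S j" for M'
        using matching_edge_unique[of M' "2 * n" "{a, i}" "{a, j}" a] that
        by (auto simp: doubleton_eq_iff)
      with \<open>i \<noteq> j\<close> show "?S i \<inter> ?S j = {}" by blast
    qed
  qed (auto intro: finite_subset[OF _ finite_matchings])
  also have "\<dots> = card ?J * card (?S b)" using same by simp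
  also have "card ?J = 2 * (n - 1)" using ab(1) c by (simp add: card_Diff_subset)
  finally show ?thesis by simp
qed

section \<open>The two eigenvectors\<close>

lemma matching_derangement_graph_edge:
  assumes "M \<in> matchings (2 * n)" "M' \<in> matchings (2 * n)"
  shows "{M, M'} \<in> snd (matching_derangement_graph n) \<longleftrightarrow> M' \<inter> M = {}"
  using assms by (auto simp: matching_derangement_graph_def Let_def doubleton_eq_iff)

lemma matching_derangement_graph_eigenvalueI:
  fixes f :: "nat set set \<Rightarrow> real"
  assumes "M\<^sub>0 \<in> matchings (2 * n)" "f M\<^sub>0 \<noteq> 0"
    and eq: "\<And>M. M \<in> matchings (2 * n) \<Longrightarrow>
      (\<Sum>M' | M' \<in> matchings (2 * n) \<and> M' \<inter> M = {}. f M') = k * f M"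
  shows "graph_eigenvalue (matching_derangement_graph n) k"
proof (rule graph_eigenvalueI)
  have V: "fst (matching_derangement_graph n) = matchings (2 * n)"
    by (simp add: matching_derangement_graph_def Let_def)
  show "finite (fst (matching_derangement_graph n))" unfolding V by (rule finite_matchings)
  show "M\<^sub>0 \<in> fst (matching_derangement_graph n)" unfolding V by fact
  show "f M\<^sub>0 \<noteq> 0" by fact
  fix M assume "M \<in> fst (matching_derangement_graph n)"
  then have M: "M \<in> matchings (2 * n)" unfolding V .
  have "(\<Sum>M'\<in>matchings (2 * n). if {M, M'} \<in> snd (matching_derangement_graph n) then f M' else 0)
    = (\<Sum>M'\<in>matchings (2 * n). if M' \<inter> M = {} then f M' else 0)"
    by (intro sum.cong) (simp_all add: matching_derangement_graph_edge[OF M])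
  also have "\<dots> = (\<Sum>M' | M' \<in> matchings (2 * n) \<and> M' \<inter> M = {}. f M')"
    by (rule sum.inter_filter[symmetric, OF finite_matchings])
  also note eq[OF M]
  finally show "(\<Sum>M'\<in>fst (matching_derangement_graph n).
      if {M, M'} \<in> snd (matching_derangement_graph n) then f M' else 0) = k * f M"
    unfolding V .
qed

theorem theorem3p7:
  fixes n :: nat and M\<^sub>0 :: "nat set set"
  assumes "n \<ge> 2"
    and "M\<^sub>0 \<in> perfect_matchings (complete_graph (2 * n))"
  shows "graph_eigenvalue (matching_derangement_graph n) (real (matching_derangements n M\<^sub>0))
    \<and> graph_eigenvalue (matching_derangement_graph n)
        (- (real (matching_derangements n M\<^sub>0) / (2 * (real n - 1))))"
proof
  let ?d = "real (matching_derangements n M\<^sub>0)"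
  let ?N = "\<lambda>M. {M' \<in> matchings (2 * n). M' \<inter> M = {}}"
  have card_N: "real (card (?N M)) = ?d" if "M \<in> matchings (2 * n)" for M
    using matching_derangements_eq[OF that assms(2)] by (simp add: matching_derangements_def)
  have fin: "finite (?N M)" for M by (rule finite_subset[OF _ finite_matchings]) auto
  \<comment> \<open>In a regular graph the constant function has the degree as its
    eigenvalue.\<close>
  show "graph_eigenvalue (matching_derangement_graph n) ?d"
    by (rule matching_derangement_graph_eigenvalueI[OF assms(2), of "\<lambda>_. 1"])
      (simp_all add: card_N)
  \<comment> \<open>With value \<open>- 1\<close> off the class of \<open>{0, 1}\<close>, a matching
    in that class has neighbour sum \<open>- ?d\<close>; the wanted eigenvalue then forces the value
    \<open>2 * (real n - 1)\<close> on the class.\<close>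
  define f :: "nat set set \<Rightarrow> real" where "f M = (if {0, 1} \<in> M then 2 * (real n - 1) else - 1)" for M
  have n: "real n - 1 > 0" using assms(1) by simp
  show "graph_eigenvalue (matching_derangement_graph n) (- (?d / (2 * (real n - 1))))"
  proof (rule matching_derangement_graph_eigenvalueI[OF assms(2), of f])
    show "f M\<^sub>0 \<noteq> 0" using n by (simp add: f_def)
    fix M assume M: "M \<in> matchings (2 * n)"
    show "sum f (?N M) = - (?d / (2 * (real n - 1))) * f M"
    proof (cases "{0, 1} \<in> M")
      case True
      then have "sum f (?N M) = (\<Sum>M'\<in>?N M. - 1)"
        by (intro sum.cong) (auto simp: f_def)
      also have "\<dots> = - ?d" using card_N[OF M] by simp
      finally show ?thesis using True n by (simp add: f_def)
    next
      case False
      let ?a = "real (card {M' \<in> matchings (2 * n). M' \<inter> M = {} \<and> {0, 1} \<in> M'})"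
      have "real (2 * (n - 1)) * ?a = ?d"
        using card_derangements_through_edge[OF M, of 0 1] False assms(1)
        by (simp add: matching_derangements_eq[OF assms(2) M] flip: of_nat_mult)
      then have a: "2 * (real n - 1) * ?a = ?d" using assms(1) by (simp add: of_nat_diff)
      \<comment> \<open>Writing \<open>f\<close> as an affine function of the indicator of the class
        reduces the sum to the two counts \<open>?a\<close> and \<open>?d\<close>; as
        \<open>?d\<close> is \<open>2 * (real n - 1)\<close> times \<open>?a\<close>, only
        \<open>?a\<close> remains.\<close>
      have "sum f (?N M) = (\<Sum>M'\<in>?N M. (2 * (real n - 1) + 1) * of_bool ({0, 1} \<in> M') - 1)"
        by (intro sum.cong) (auto simp: f_def)
      also have "\<dots> = (2 * (real n - 1) + 1) * ?a - ?d"
        using card_N[OF M] fin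
        by (simp add: sum_subtractf sum_distrib_left[symmetric] Collect_conj_eq Int_assoc)
      also have "\<dots> = ?a" using a by (simp add: algebra_simps)
      finally show ?thesis using False n a by (simp add: f_def field_simps)
    qed
  qed
qed

end
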